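(* There is an algorithm that, given an instance $(G,k)$ of \textsc{$k\times k$ Clique} with $k\ge 2$, constructs an instance $(S,k,d)$ of \textsc{Minimax Approval Voting} such that $(S,k,d)$ is a yes-instance if and only if $(G,k)$ is a yes-instance, $d=3k-3$, and $S$ consists of $O\!\left(k^2\binom{2k-2}{k-2}\right)$ strings, each of length $k^2+2k-2$. The construction takes time polynomial in the size of the output.
   Context: For $n\in\mathbb{N}$ let $[n]=\{1,\dots,n\}$. For $x,y\in\{0,1\}^m$, $\mathrm{H}(x,y)$ denotes the Hamming distance (number of positions where they differ), and $\mathrm{ones}(x)$ the number of $1$'s in $x$. \textsc{$k\times k$ Clique}: given an integer $k$ and a graph $G$ with vertex set $[k]\times[k]$ (vertex $(a,b)$ lies in row $a$ and column $b$), decide whether $G$ contains a clique with exactly one vertex in each row. \textsc{Minimax Approval Voting}: given a multiset $S=\{s_1,\dots,s_n\}$ of strings in $\{0,1\}^m$ and integers $k,d$, decide whether there exists $s\in\{0,1\}^m$ with $\mathrm{ones}(s)=k$ and $\mathrm{H}(s,s_i)\le d$ for all $i=1,\dots,n$. *)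

theory Defs
  imports "HOL-Computational_Algebra.Polynomial" "HOL-Library.Multiset"
begin

section \<open>The two decision problems\<close>

definition kk_vertices :: "nat \<Rightarrow> (nat \<times> nat) set" where
  "kk_vertices k = {1..k} \<times> {1..k}"

definition kk_graph :: "nat \<Rightarrow> (nat \<times> nat) set set \<Rightarrow> bool" where
  "kk_graph k E \<longleftrightarrow>
    E \<subseteq> {{u, v} | u v. u \<in> kk_vertices k \<and> v \<in> kk_vertices k \<and> u \<noteq> v}"

definition kk_clique :: "nat \<Rightarrow> (nat \<times> nat) set set \<Rightarrow> bool" where
  "kk_clique k E \<longleftrightarrow>
    (\<exists>C \<subseteq> kk_vertices k.
       (\<forall>u\<in>C. \<forall>v\<in>C. u \<noteq> v \<longrightarrow> {u, v} \<in> E) \<and>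
       (\<forall>a\<in>{1..k}. \<exists>!v. v \<in> C \<and> fst v = a))"

definition ones :: "bool list \<Rightarrow> nat" where
  "ones x = count_list x True"

definition hamming :: "bool list \<Rightarrow> bool list \<Rightarrow> nat" where
  "hamming x y = card {i. i < length x \<and> x ! i \<noteq> y ! i}"

definition minimax_approval :: "nat \<Rightarrow> bool list multiset \<Rightarrow> nat \<Rightarrow> nat \<Rightarrow> bool" where
  "minimax_approval m S k d \<longleftrightarrow>
    (\<exists>s. length s = m \<and> ones s = k \<and> (\<forall>t\<in>#S. hamming s t \<le> d))"

section \<open>Model of computation\<close>

text \<open>
  Jones' language WHILE with its unit-cost time measure. The values are binary trees; a value
  counts as false iff it is a leaf. Every elementary operation takes constant time when trees
  are stored as shared heap cells, and a run of \<open>t\<close> steps is simulated by a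
  Turing machine in time polynomial in \<open>t\<close> and the input size, so polynomial time has its
  usual meaning.
\<close>

datatype tree = Leaf | Node tree tree

fun left :: "tree \<Rightarrow> tree" where
  "left Leaf = Leaf"
| "left (Node x y) = x"

fun right :: "tree \<Rightarrow> tree" where
  "right Leaf = Leaf"
| "right (Node x y) = y"

datatype expr = Var nat | Nil_e | Cons_e expr expr | Hd_e expr | Tl_e expr

datatype com =
  Assign nat expr
| Seq com com
| Cond expr com com
| While expr com

type_synonym store = "nat \<Rightarrow> tree"

fun eval_expr :: "expr \<Rightarrow> store \<Rightarrow> tree" where
  "eval_expr (Var x) \<sigma> = \<sigma> x"
| "eval_expr Nil_e \<sigma> = Leaf"
| "eval_expr (Cons_e e f) \<sigma> = Node (eval_expr e \<sigma>) (eval_expr f \<sigma>)"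
| "eval_expr (Hd_e e) \<sigma> = left (eval_expr e \<sigma>)"
| "eval_expr (Tl_e e) \<sigma> = right (eval_expr e \<sigma>)"

fun expr_time :: "expr \<Rightarrow> nat" where
  "expr_time (Var x) = 1"
| "expr_time Nil_e = 1"
| "expr_time (Cons_e e f) = expr_time e + expr_time f + 1"
| "expr_time (Hd_e e) = expr_time e + 1"
| "expr_time (Tl_e e) = expr_time e + 1"

text \<open>\<open>exec c \<sigma> t \<sigma>'\<close>: started in store \<open>\<sigma>\<close>, the command \<open>c\<close> halts
  after \<open>t\<close> steps in store \<open>\<sigma>'\<close>.\<close>

inductive exec :: "com \<Rightarrow> store \<Rightarrow> nat \<Rightarrow> store \<Rightarrow> bool" where
  Assign: "exec (Assign x e) \<sigma> (expr_time e + 1) (\<sigma>(x := eval_expr e \<sigma>))"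
| Seq: "exec c1 \<sigma> t1 \<sigma>' \<Longrightarrow> exec c2 \<sigma>' t2 \<sigma>'' \<Longrightarrow> exec (Seq c1 c2) \<sigma> (t1 + t2 + 1) \<sigma>''"
| CondTrue: "eval_expr e \<sigma> \<noteq> Leaf \<Longrightarrow> exec c1 \<sigma> t \<sigma>' \<Longrightarrow>
    exec (Cond e c1 c2) \<sigma> (expr_time e + t + 1) \<sigma>'"
| CondFalse: "eval_expr e \<sigma> = Leaf \<Longrightarrow> exec c2 \<sigma> t \<sigma>' \<Longrightarrow>
    exec (Cond e c1 c2) \<sigma> (expr_time e + t + 1) \<sigma>'"
| WhileFalse: "eval_expr e \<sigma> = Leaf \<Longrightarrow> exec (While e c) \<sigma> (expr_time e + 1) \<sigma>"
| WhileTrue: "eval_expr e \<sigma> \<noteq> Leaf \<Longrightarrow> exec c \<sigma> t1 \<sigma>' \<Longrightarrow> exec (While e c) \<sigma>' t2 \<sigma>'' \<Longrightarrow>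
    exec (While e c) \<sigma> (expr_time e + t1 + t2 + 1) \<sigma>''"

inductive_cases exec_AssignE: "exec (Assign x e) \<sigma> t \<sigma>'"
inductive_cases exec_SeqE: "exec (Seq c1 c2) \<sigma> t \<sigma>'"
inductive_cases exec_CondE: "exec (Cond e c1 c2) \<sigma> t \<sigma>'"
inductive_cases exec_WhileE: "exec (While e c) \<sigma> t \<sigma>'"

lemma exec_deterministic:
  "exec c \<sigma> t \<sigma>' \<Longrightarrow> exec c \<sigma> u \<sigma>'' \<Longrightarrow> t = u \<and> \<sigma>' = \<sigma>''"
proof (induction arbitrary: u \<sigma>'' rule: exec.induct)
  case (Assign x e \<sigma>)
  then show ?case by (auto elim: exec_AssignE)
next
  case (Seq c1 \<sigma> t1 \<sigma>1 c2 t2 \<sigma>2)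
  from Seq.prems obtain u1 u2 \<tau> where
    "exec c1 \<sigma> u1 \<tau>" "exec c2 \<tau> u2 \<sigma>''" "u = u1 + u2 + 1"
    by (auto elim: exec_SeqE)
  with Seq.IH show ?case by metis
next
  case (CondTrue e \<sigma> c1 t \<sigma>' c2)
  from CondTrue.prems CondTrue.hyps obtain v where "exec c1 \<sigma> v \<sigma>''" "u = expr_time e + v + 1"
    by (cases rule: exec_CondE) auto
  with CondTrue.IH show ?case by metis
next
  case (CondFalse e \<sigma> c2 t \<sigma>' c1)
  from CondFalse.prems CondFalse.hyps obtain v where "exec c2 \<sigma> v \<sigma>''" "u = expr_time e + v + 1"
    by (cases rule: exec_CondE) auto
  with CondFalse.IH show ?case by metis
next
  case (WhileFalse e \<sigma> c)
  from WhileFalse.prems WhileFalse.hyps show ?case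
    by (cases rule: exec_WhileE) auto
next
  case (WhileTrue e \<sigma> c t1 \<sigma>1 t2 \<sigma>2)
  from WhileTrue.prems WhileTrue.hyps obtain u1 u2 \<tau> where
    "exec c \<sigma> u1 \<tau>" "exec (While e c) \<tau> u2 \<sigma>''" "u = expr_time e + u1 + u2 + 1"
    by (cases rule: exec_WhileE) auto
  with WhileTrue.IH show ?case by metis
qed

text \<open>Input and output are passed in variable \<open>0\<close>; all other variables start as leaves.\<close>

definition runs :: "com \<Rightarrow> tree \<Rightarrow> nat \<Rightarrow> tree \<Rightarrow> bool" where
  "runs c x t y \<longleftrightarrow> (\<exists>\<sigma>. exec c ((\<lambda>_. Leaf)(0 := x)) t \<sigma> \<and> \<sigma> 0 = y)"

section \<open>Instances as data\<close>

fun enc_bool :: "bool \<Rightarrow> tree" where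
  "enc_bool False = Leaf"
| "enc_bool True = Node Leaf Leaf"

fun enc_list :: "('a \<Rightarrow> tree) \<Rightarrow> 'a list \<Rightarrow> tree" where
  "enc_list f [] = Leaf"
| "enc_list f (x # xs) = Node (f x) (enc_list f xs)"

text \<open>Numbers are written in unary.\<close>

definition enc_nat :: "nat \<Rightarrow> tree" where
  "enc_nat n = enc_list enc_bool (replicate n False)"

definition vertex_list :: "nat \<Rightarrow> (nat \<times> nat) list" where
  "vertex_list k = List.product [1..<Suc k] [1..<Suc k]"

definition adj_matrix :: "nat \<Rightarrow> (nat \<times> nat) set set \<Rightarrow> bool list list" where
  "adj_matrix k E = map (\<lambda>u. map (\<lambda>v. {u, v} \<in> E) (vertex_list k)) (vertex_list k)"

definition enc_kk_clique :: "nat \<Rightarrow> (nat \<times> nat) set set \<Rightarrow> tree" where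
  "enc_kk_clique k E = Node (enc_nat k) (enc_list (enc_list enc_bool) (adj_matrix k E))"

text \<open>The multiset of strings is represented by a list in arbitrary order.\<close>

definition enc_minimax_approval :: "bool list list \<Rightarrow> nat \<Rightarrow> nat \<Rightarrow> tree" where
  "enc_minimax_approval ss k d =
    Node (enc_list (enc_list enc_bool) ss) (Node (enc_nat k) (enc_nat d))"

end

theory Submission
  imports Defs
begin

text \<open>
  The first \<open>k\<^sup>2\<close> positions of a string stand for the vertices, the last \<open>2k - 2\<close> are auxiliary.
  For a string \<open>s\<close> with \<open>k\<close> ones and a string \<open>t\<close> with \<open>2k - 2\<close> ones, the distance is at most
  \<open>3k - 3\<close> iff \<open>s\<close> and \<open>t\<close> share a one; if \<open>t\<close> has fewer ones, it always is.

  A row together with an auxiliary set of size \<open>k - 2\<close> has \<open>2k - 2\<close> ones. If \<open>s\<close> misses the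
  row, it must meet every auxiliary set of size \<open>k - 2\<close>, hence contain more than \<open>k\<close> auxiliary
  positions, which is impossible. So \<open>s\<close> picks exactly one vertex in each row. For non-adjacent
  \<open>u\<close>, \<open>v\<close> in different rows, the string of the two rows without \<open>u\<close> and \<open>v\<close> also has
  \<open>2k - 2\<close> ones, and \<open>s\<close> meets it iff it does not pick both \<open>u\<close> and \<open>v\<close>.

  Running over all \<open>2^(2k - 2)\<close> auxiliary sets, truncated to at most \<open>k - 2\<close> elements, is
  affordable because \<open>4^(k - 1)\<close> is at most \<open>4k\<close> times the binomial coefficient. The program is a
  fixed nesting of loops over lists no longer than the output, so its running time is polynomial.
\<close>

subsection \<open>The reduction\<close>

definition common :: "bool list \<Rightarrow> bool list \<Rightarrow> nat" where
  "common x y = card {i. i < length x \<and> x ! i \<and> y ! i}"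

lemma ones_simps [simp]:
  "ones [] = 0" "ones (b # x) = (if b then Suc (ones x) else ones x)"
  "ones (x @ y) = ones x + ones y" "ones (replicate n False) = 0"
  by (auto simp: ones_def count_list_0_iff)

lemma card_index_Cons:
  "card {i. i < length (x # xs) \<and> P i} =
     (if P 0 then 1 else 0) + card {i. i < length xs \<and> P (Suc i)}"
proof -
  have "{i. i < length (x # xs) \<and> P i} =
      (if P 0 then {0} else {}) \<union> Suc ` {i. i < length xs \<and> P (Suc i)}"
    by (auto simp: image_iff less_Suc_eq_0_disj)
  then show ?thesis
    by (auto simp: card_image card_insert_if)
qed

lemma ones_eq_card: "ones x = card {i. i < length x \<and> x ! i}"
proof (induction x)
  case (Cons b x)
  then show ?case by (simp only: card_index_Cons) auto
qed simp

lemma ones_map: "distinct xs \<Longrightarrow> ones (map f xs) = card {x \<in> set xs. f x}"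
proof (induction xs)
  case (Cons a xs)
  have "{x \<in> set (a # xs). f x} = (if f a then {a} else {}) \<union> {x \<in> set xs. f x}"
    by auto
  with Cons show ?case by (auto simp: card_insert_if)
qed simp

text \<open>Position by position: a one of just one string counts once on each side, a shared one
  twice on each side.\<close>

lemma hamming_plus_common:
  "length x = length y \<Longrightarrow> hamming x y + 2 * common x y = ones x + ones y"
proof (induction x y rule: list_induct2)
  case (Cons a x b y)
  have "hamming (a # x) (b # y) = (if a \<noteq> b then 1 else 0) + hamming x y"
       "common (a # x) (b # y) = (if a \<and> b then 1 else 0) + common x y"
    unfolding hamming_def common_def by (simp_all only: card_index_Cons) auto
  with Cons.IH show ?case by auto
qed (simp add: hamming_def common_def)

lemma common_pos_iff: "0 < common x y \<longleftrightarrow> (\<exists>i < length x. x ! i \<and> y ! i)"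
  unfolding common_def by (auto simp: card_gt_0_iff)

section \<open>Row strings and pair strings\<close>

lemma distinct_vertex_list [simp]: "distinct (vertex_list k)"
  by (simp add: vertex_list_def distinct_product)

lemma set_vertex_list [simp]: "set (vertex_list k) = kk_vertices k"
  by (auto simp: vertex_list_def kk_vertices_def)

lemma length_vertex_list [simp]: "length (vertex_list k) = k\<^sup>2"
  by (simp add: vertex_list_def power2_eq_square)

text \<open>The vertices are listed backwards because the program builds strings by consing.\<close>

definition row_string :: "nat \<Rightarrow> nat \<Rightarrow> bool list \<Rightarrow> bool list" where
  "row_string k a X = map (\<lambda>(x, y). x = a) (rev (vertex_list k)) @ X"

text \<open>If \<open>u\<close> and \<open>v\<close> lie in the same row, the string has only \<open>k - 1\<close> ones and imposes no
  constraint, so the program need not compare rows.\<close>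

definition pair_string :: "nat \<Rightarrow> nat \<times> nat \<Rightarrow> nat \<times> nat \<Rightarrow> bool list" where
  "pair_string k u v =
     map (\<lambda>(x, y). if x = fst u then y \<noteq> snd u else x = fst v \<and> y \<noteq> snd v)
       (rev (vertex_list k)) @ replicate (2 * k - 2) False"

lemma length_row_string: "length (row_string k a X) = k\<^sup>2 + length X"
  by (simp add: row_string_def)

lemma length_pair_string: "length (pair_string k u v) = k\<^sup>2 + (2 * k - 2)"
  by (simp add: pair_string_def)

lemma ones_row_string: "a \<in> {1..k} \<Longrightarrow> ones (row_string k a X) = k + ones X"
proof -
  assume "a \<in> {1..k}"
  then have "{x \<in> kk_vertices k. (\<lambda>(x, y). x = a) x} = {a} \<times> {1..k}"
    by (auto simp: kk_vertices_def)
  then show ?thesis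
    by (simp add: row_string_def ones_map)
qed

text \<open>Each of two distinct rows loses one vertex. For equal rows only the first branch can
  produce ones, so a single row without \<open>u\<close> remains.\<close>

lemma ones_pair_string:
  assumes "u \<in> kk_vertices k" "v \<in> kk_vertices k"
  shows "ones (pair_string k u v) = (if fst u = fst v then k - 1 else 2 * k - 2)"
proof -
  have c: "card ({a} \<times> ({1..k} - {b})) = k - 1" if "b \<in> {1..k}" for a b :: nat
    using that by (simp add: card_cartesian_product)
  let ?B = "{x \<in> kk_vertices k. (\<lambda>(x, y). if x = fst u then y \<noteq> snd u
    else x = fst v \<and> y \<noteq> snd v) x}"
  have B: "?B = (if fst u = fst v then {fst u} \<times> ({1..k} - {snd u})
      else {fst u} \<times> ({1..k} - {snd u}) \<union> {fst v} \<times> ({1..k} - {snd v}))"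
    using assms by (auto simp: kk_vertices_def)
  have s: "snd u \<in> {1..k}" "snd v \<in> {1..k}"
    using assms by (auto simp: kk_vertices_def)
  have "card ?B = (if fst u = fst v then k - 1 else 2 * k - 2)"
  proof (cases "fst u = fst v")
    case True
    then show ?thesis using B c s by simp
  next
    case False
    have "card ({fst u} \<times> ({1..k} - {snd u}) \<union> {fst v} \<times> ({1..k} - {snd v})) =
        (k - 1) + (k - 1)"
      using c[OF s(1), of "fst u"] c[OF s(2), of "fst v"] False by (subst card_Un_disjoint) auto
    with B False show ?thesis by simp
  qed
  then show ?thesis
    by (simp add: pair_string_def ones_map)
qed

section \<open>The threshold \<open>3k - 3\<close> and the equivalence with cliques\<close>

lemma hamming_le_iff:
  assumes "length s = length t" "ones s = k" "ones t = 2 * k - 2" "k \<ge> 2"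
  shows "hamming s t \<le> 3 * k - 3 \<longleftrightarrow> (\<exists>i < length s. s ! i \<and> t ! i)"
  \<comment> \<open>The ones add up to \<open>3k - 2\<close>, one too many, and every shared one
    lowers the distance by 2.\<close>
  using hamming_plus_common[OF assms(1)] assms common_pos_iff[of s t] by auto

lemma hamming_le_of_few_ones:
  assumes "length s = length t" "ones s = k" "ones t \<le> 2 * k - 3" "k \<ge> 2"
  shows "hamming s t \<le> 3 * k - 3"
  using hamming_plus_common[OF assms(1)] assms by auto

text \<open>The vertices selected by \<open>s\<close> form a set \<open>C\<close> of at most
  \<open>k\<close> elements that meets all \<open>k\<close> rows, so \<open>fst\<close> is injective
  on it; the pair strings then force adjacency.\<close>

lemma minimax_approval_imp_clique:
  assumes k: "k \<ge> 2"
    and s: "length s = k\<^sup>2 + (2 * k - 2)" "ones s = k"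
    and row: "\<And>a X. a \<in> {1..k} \<Longrightarrow> length X = 2 * k - 2 \<Longrightarrow> ones X = k - 2 \<Longrightarrow>
      hamming s (row_string k a X) \<le> 3 * k - 3"
    and pair: "\<And>u v. u \<in> kk_vertices k \<Longrightarrow> v \<in> kk_vertices k \<Longrightarrow> {u, v} \<notin> E \<Longrightarrow>
      hamming s (pair_string k u v) \<le> 3 * k - 3"
  shows "kk_clique k E"
proof -
  define V where "V = rev (vertex_list k)"
  define I where "I = {i. i < k\<^sup>2 \<and> s ! i}"
  define C where "C = (!) V ` I"
  have V: "length V = k\<^sup>2" "set V = kk_vertices k"
    by (simp_all add: V_def)
  have "I \<subseteq> {i. i < length s \<and> s ! i}"
    using s by (auto simp: I_def)
  then have "card I \<le> k"
    using s(2) card_mono[of "{i. i < length s \<and> s ! i}" I] by (simp add: ones_eq_card)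
  moreover have "finite I"
    by (simp add: I_def)
  ultimately have C: "finite C" "card C \<le> k" "C \<subseteq> kk_vertices k"
    using card_image_le[of I "(!) V"] V nth_mem[of _ V] by (auto simp: C_def I_def)
  have rows: "\<exists>v\<in>C. fst v = a" if a: "a \<in> {1..k}" for a
  proof (rule ccontr)
    assume no: "\<not> (\<exists>v\<in>C. fst v = a)"
    define J where "J = {j. j < 2 * k - 2 \<and> s ! (k\<^sup>2 + j)}"
    have "(+) (k\<^sup>2) ` J \<subseteq> {i. i < length s \<and> s ! i}"
      using s by (auto simp: J_def)
    then have "card ((+) (k\<^sup>2) ` J) \<le> k"
      using s(2) card_mono[of "{i. i < length s \<and> s ! i}" "(+) (k\<^sup>2) ` J"]
      by (simp add: ones_eq_card)
    then have "card J \<le> k"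
      by (simp add: card_image)
    moreover have "J \<subseteq> {..<2 * k - 2}"
      by (auto simp: J_def)
    \<comment> \<open>At most \<open>k\<close> of the \<open>2k - 2\<close> auxiliary positions
      carry a one of \<open>s\<close>, which leaves \<open>k - 2\<close> positions for a tail
      \<open>X\<close> disjoint from \<open>s\<close>.\<close>
    ultimately have "k - 2 \<le> card ({..<2 * k - 2} - J)"
      by (subst card_Diff_subset) (auto intro: finite_subset)
    then obtain B where B: "B \<subseteq> {..<2 * k - 2} - J" "card B = k - 2"
      by (meson obtain_subset_with_card_n)
    define X where "X = map (\<lambda>j. j \<in> B) [0..<2 * k - 2]"
    have "{j \<in> set [0..<2 * k - 2]. j \<in> B} = B"
      using B by auto
    then have X: "length X = 2 * k - 2" "ones X = k - 2"
      using B by (simp_all add: X_def ones_map)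
    have "\<exists>i < length s. s ! i \<and> row_string k a X ! i"
      using row[OF a X] hamming_le_iff[of s "row_string k a X" k] s k a X
      by (simp add: length_row_string ones_row_string)
    then obtain i where i: "i < length s" "s ! i" "row_string k a X ! i"
      by blast
    show False
    proof (cases "i < k\<^sup>2")
      case True
      then have "fst (V ! i) = a"
        using i(3) V(1) by (simp add: row_string_def nth_append V_def split: prod.splits)
      with no True i show False
        by (auto simp: C_def I_def)
    next
      case False
      then obtain j where j: "i = k\<^sup>2 + j"
        by (metis le_add_diff_inverse not_less)
      with i s have "j < 2 * k - 2" "j \<in> J" by (auto simp: J_def)
      moreover from this have "j \<in> B"
        using i(3) j by (simp add: row_string_def nth_append X_def)
      ultimately show False
        using B by auto
    qed
  qed
  then have "{1..k} \<subseteq> fst ` C"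
    by force
  moreover have "fst ` C \<subseteq> {1..k}"
    using C by (auto simp: kk_vertices_def)
  ultimately have fC: "fst ` C = {1..k}"
    by blast
  then have "card (fst ` C) = card C"
    using C card_image_le[of C fst] by simp
  then have inj: "inj_on fst C"
    using C by (intro eq_card_imp_inj_on)
  have clique: "{u, v} \<in> E" if u: "u \<in> C" and v: "v \<in> C" and uv: "u \<noteq> v" for u v
  proof (rule ccontr)
    assume "{u, v} \<notin> E"
    moreover have ne: "fst u \<noteq> fst v"
      using inj u v uv by (auto dest: inj_onD)
    moreover have "u \<in> kk_vertices k" "v \<in> kk_vertices k"
      using C u v by auto
    ultimately have "\<exists>i < length s. s ! i \<and> pair_string k u v ! i"
      using pair[of u v] hamming_le_iff[of s "pair_string k u v" k] s k
      by (simp add: length_pair_string ones_pair_string)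
    then obtain i where i: "i < length s" "s ! i" "pair_string k u v ! i"
      by blast
    then have "i < k\<^sup>2"
      using s by (auto simp: pair_string_def nth_append split: if_splits)
    moreover from this i have w: "V ! i \<in> C"
      by (auto simp: C_def I_def)
    \<comment> \<open>The shared one is a vertex of \<open>C\<close> in the row of \<open>u\<close>
      or \<open>v\<close> but different from it, contrary to injectivity of
      \<open>fst\<close>.\<close>
    ultimately have "fst (V ! i) = fst u \<and> snd (V ! i) \<noteq> snd u \<or>
        fst (V ! i) = fst v \<and> snd (V ! i) \<noteq> snd v"
      using i(3) V(1)
      by (auto simp: pair_string_def nth_append V_def split: prod.splits if_splits)
    then show False
      using inj_onD[OF inj _ w u] inj_onD[OF inj _ w v] by auto
  qed
  have "\<exists>!v. v \<in> C \<and> fst v = a" if "a \<in> {1..k}" for a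
    using rows[OF that] inj by (auto dest: inj_onD)
  with C clique show ?thesis
    unfolding kk_clique_def by (intro exI[of _ C]) auto
qed

text \<open>Take the indicator of the clique with a zero tail. Tails \<open>X\<close> with fewer
  than \<open>k - 2\<close> ones are covered too, since the enumeration produces them.\<close>

lemma clique_imp_minimax_approval:
  assumes k: "k \<ge> 2" and "kk_clique k E"
  shows "\<exists>s. length s = k\<^sup>2 + (2 * k - 2) \<and> ones s = k \<and>
    (\<forall>a\<in>{1..k}. \<forall>X. length X = 2 * k - 2 \<longrightarrow> ones X \<le> k - 2 \<longrightarrow>
      hamming s (row_string k a X) \<le> 3 * k - 3) \<and>
    (\<forall>u\<in>kk_vertices k. \<forall>v\<in>kk_vertices k. {u, v} \<notin> E \<longrightarrow>
      hamming s (pair_string k u v) \<le> 3 * k - 3)"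
proof -
  obtain C where C: "C \<subseteq> kk_vertices k"
    and clique: "\<forall>u\<in>C. \<forall>v\<in>C. u \<noteq> v \<longrightarrow> {u, v} \<in> E"
    and "\<forall>a\<in>{1..k}. \<exists>!v. v \<in> C \<and> fst v = a"
    using assms(2) unfolding kk_clique_def by (elim exE conjE)
  note rows = bspec[OF this(3)]
  have row: "\<exists>v\<in>C. fst v = a" if "a \<in> {1..k}" for a
    using ex1_implies_ex[OF rows[OF that]] by blast
  define V where "V = rev (vertex_list k)"
  have V: "distinct V" "length V = k\<^sup>2" "set V = kk_vertices k"
    by (simp_all add: V_def)
  define s where "s = map (\<lambda>v. v \<in> C) V @ replicate (2 * k - 2) False"
  have len: "length s = k\<^sup>2 + (2 * k - 2)"
    by (simp add: s_def V)
  have "{1..k} \<subseteq> fst ` C"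
    using row by force
  moreover have "fst ` C \<subseteq> {1..k}"
    using C by (auto simp: kk_vertices_def)
  ultimately have "fst ` C = {1..k}"
    by blast
  moreover have "inj_on fst C"
  proof (rule inj_onI)
    fix u v assume "u \<in> C" "v \<in> C" "fst u = fst v"
    moreover from this C have "fst u \<in> {1..k}"
      by (auto simp: kk_vertices_def)
    ultimately show "u = v"
      using rows by metis
  qed
  ultimately have "card C = k"
    by (metis card_atLeastAtMost card_image diff_Suc_1)
  moreover have "{v \<in> set V. v \<in> C} = C"
    using C V by auto
  ultimately have ones: "ones s = k"
    using V by (simp add: s_def ones_map)
  have hit: "\<exists>i < length s. s ! i \<and> (map f V @ X) ! i"
    if w: "w \<in> C" "f w" for f w X
  proof -
    obtain i where "i < length V" "V ! i = w"
      using w C V(3) by (metis in_set_conv_nth subsetD)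
    with w show ?thesis
      by (intro exI[of _ i]) (auto simp: s_def nth_append)
  qed
  have "hamming s (row_string k a X) \<le> 3 * k - 3"
    if a: "a \<in> {1..k}" and X: "length X = 2 * k - 2" "ones X \<le> k - 2" for a X
  proof (cases "ones X = k - 2")
    case True
    obtain w where "w \<in> C" "fst w = a"
      using row[OF a] by blast
    then have "\<exists>i < length s. s ! i \<and> row_string k a X ! i"
      unfolding row_string_def V_def[symmetric] by (intro hit[of w]) (auto split: prod.splits)
    then show ?thesis
      using True a X k len ones
      by (subst hamming_le_iff) (auto simp: length_row_string ones_row_string)
  next
    case False
    then show ?thesis
      using a X k len ones
      by (intro hamming_le_of_few_ones) (auto simp: length_row_string ones_row_string)
  qed
  moreover have "hamming s (pair_string k u v) \<le> 3 * k - 3"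
    if u: "u \<in> kk_vertices k" and v: "v \<in> kk_vertices k" and uv: "{u, v} \<notin> E" for u v
  proof (cases "fst u = fst v")
    case True
    then show ?thesis
      using u v k len ones
      by (intro hamming_le_of_few_ones) (auto simp: length_pair_string ones_pair_string)
  next
    case False
    then have "u \<notin> C \<or> v \<notin> C"
      using clique uv by auto
    moreover obtain x y where "x \<in> C" "fst x = fst u" "y \<in> C" "fst y = fst v"
      using row[of "fst u"] row[of "fst v"] u v by (auto simp: kk_vertices_def)
    \<comment> \<open>If \<open>u\<close> is not in \<open>C\<close>, the clique vertex in its row
      differs from \<open>u\<close>; likewise for \<open>v\<close>.\<close>
    ultimately obtain w where "w \<in> C"
      "fst w = fst u \<and> snd w \<noteq> snd u \<or> fst w = fst v \<and> snd w \<noteq> snd v"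
      by (metis prod.expand)
    then have "\<exists>i < length s. s ! i \<and> pair_string k u v ! i"
      unfolding pair_string_def V_def[symmetric] using False
      by (intro hit[of w]) (auto split: prod.splits)
    then show ?thesis
      using False u v k len ones
      by (subst hamming_le_iff) (auto simp: length_pair_string ones_pair_string)
  qed
  ultimately show ?thesis
    using len ones by blast
qed

text \<open>A pair consists of the number of ones that may still be added and of a string. With an
  exhausted budget the string is extended by a zero twice: the duplicates are harmless and keep
  the number of strings at exactly a power of two.\<close>

fun spend :: "nat \<times> bool list \<Rightarrow> (nat \<times> bool list) list" where
  "spend (n, X) = [(n, False # X), (if n = 0 then (0, False # X) else (n - 1, True # X))]"

text \<open>The \<open>rev\<close> reproduces the order in which the program conses new entries onto
  an accumulator.\<close>

fun budgeted :: "nat \<Rightarrow> nat \<Rightarrow> (nat \<times> bool list) list" where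
  "budgeted b 0 = [(b, [])]"
| "budgeted b (Suc j) = rev (concat (map spend (budgeted b j)))"

lemma length_budgeted: "length (budgeted b j) = 2 ^ j"
proof (induction j)
  case (Suc j)
  have "length (concat (map spend xs)) = 2 * length xs" for xs
    by (induction xs) auto
  with Suc show ?case by simp
qed simp

text \<open>Every \<open>spend\<close> preserves the sum of the ones placed and the remaining
  budget.\<close>

lemma budgeted_sound: "(n, X) \<in> set (budgeted b j) \<Longrightarrow> length X = j \<and> ones X + n \<le> b"
proof (induction j arbitrary: n X)
  case (Suc j)
  then obtain n' X' where "(n', X') \<in> set (budgeted b j)" "(n, X) \<in> set (spend (n', X'))"
    by auto
  with Suc.IH[of n' X'] show ?case
    by (auto split: if_splits)
qed simp

text \<open>The exact remaining budget is part of the claim so that the induction knows when a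
  further one is affordable.\<close>

lemma budgeted_complete: "ones X \<le> b \<Longrightarrow> (b - ones X, X) \<in> set (budgeted b (length X))"
proof (induction X)
  case (Cons x X)
  then have "(b - ones X, X) \<in> set (budgeted b (length X))"
    by (auto split: if_splits)
  moreover have "(b - ones (x # X), x # X) \<in> set (spend (b - ones X, X))"
    using Cons.prems by auto
  ultimately show ?case
    by (auto simp del: spend.simps)
qed simp

section \<open>The list of strings and correctness of the reduction\<close>

definition row_strings :: "nat \<Rightarrow> bool list list" where
  "row_strings k = concat (map (\<lambda>a. map (\<lambda>(n, X). row_string k a X)
     (budgeted (k - 2) (2 * k - 2))) (rev [1..<Suc k]))"

text \<open>Ordered pairs are run through, so two distinct non-adjacent vertices are treated twice;
  a pair with \<open>u = v\<close> lies in one row and its string imposes no constraint.\<close>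

definition pair_strings :: "nat \<Rightarrow> (nat \<times> nat) set set \<Rightarrow> bool list list" where
  "pair_strings k E = concat (map (\<lambda>u. concat (map (\<lambda>v.
     if {u, v} \<in> E then [] else [pair_string k u v]) (vertex_list k))) (vertex_list k))"

text \<open>Reversals and order mirror the program, which conses the row strings first and the pair
  strings on top.\<close>

definition reduction_strings :: "nat \<Rightarrow> (nat \<times> nat) set set \<Rightarrow> bool list list" where
  "reduction_strings k E = rev (pair_strings k E) @ rev (row_strings k)"

lemma minimax_approval_iff_clique:
  assumes k: "k \<ge> 2"
  shows "minimax_approval (k\<^sup>2 + 2 * k - 2) (mset (reduction_strings k E)) k (3 * k - 3)
    \<longleftrightarrow> kk_clique k E"
proof -
  have m: "k\<^sup>2 + 2 * k - 2 = k\<^sup>2 + (2 * k - 2)"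
    using k by simp
  have rs: "row_string k a X \<in> set (reduction_strings k E)"
    if "a \<in> {1..k}" "length X = 2 * k - 2" "ones X = k - 2" for a X
  proof -
    have "(0, X) \<in> set (budgeted (k - 2) (2 * k - 2))"
      using budgeted_complete[of X "k - 2"] that by simp
    with that show ?thesis
      by (force simp: reduction_strings_def row_strings_def)
  qed
  have ps: "pair_string k u v \<in> set (reduction_strings k E)"
    if "u \<in> kk_vertices k" "v \<in> kk_vertices k" "{u, v} \<notin> E" for u v
    using that by (force simp: reduction_strings_def pair_strings_def)
  have sub: "(\<exists>a X. t = row_string k a X \<and> a \<in> {1..k} \<and> length X = 2 * k - 2 \<and> ones X \<le> k - 2) \<or>
     (\<exists>u v. t = pair_string k u v \<and> u \<in> kk_vertices k \<and> v \<in> kk_vertices k \<and> {u, v} \<notin> E)"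
    if t: "t \<in> set (reduction_strings k E)" for t
  proof (cases "t \<in> set (row_strings k)")
    case True
    then obtain a n X where "t = row_string k a X" "a \<in> {1..k}"
      "(n, X) \<in> set (budgeted (k - 2) (2 * k - 2))"
      by (auto simp: row_strings_def)
    with budgeted_sound[of n X] show ?thesis
      by fastforce
  next
    case False
    with t show ?thesis
      by (auto simp: reduction_strings_def pair_strings_def split: if_splits)
  qed
  show ?thesis
  proof
    assume "minimax_approval (k\<^sup>2 + 2 * k - 2) (mset (reduction_strings k E)) k (3 * k - 3)"
    then obtain s where "length s = k\<^sup>2 + (2 * k - 2)" "ones s = k"
      "\<And>t. t \<in> set (reduction_strings k E) \<Longrightarrow> hamming s t \<le> 3 * k - 3"
      unfolding minimax_approval_def m by auto
    then show "kk_clique k E"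
      using rs ps by (intro minimax_approval_imp_clique[OF k]) blast+
  next
    assume "kk_clique k E"
    from clique_imp_minimax_approval[OF k this] obtain s where s:
      "length s = k\<^sup>2 + (2 * k - 2)" "ones s = k"
      "\<And>a X. a \<in> {1..k} \<Longrightarrow> length X = 2 * k - 2 \<Longrightarrow> ones X \<le> k - 2 \<Longrightarrow>
        hamming s (row_string k a X) \<le> 3 * k - 3"
      "\<And>u v. u \<in> kk_vertices k \<Longrightarrow> v \<in> kk_vertices k \<Longrightarrow> {u, v} \<notin> E \<Longrightarrow>
        hamming s (pair_string k u v) \<le> 3 * k - 3"
      by blast
    have "hamming s t \<le> 3 * k - 3" if "t \<in> set (reduction_strings k E)" for t
      using sub[OF that] s(3,4) by blast
    with s(1,2) show "minimax_approval (k\<^sup>2 + 2 * k - 2) (mset (reduction_strings k E)) k (3 * k - 3)"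
      unfolding minimax_approval_def m by auto
  qed
qed

lemma length_reduction_string:
  assumes "k \<ge> 2" "t \<in> set (reduction_strings k E)"
  shows "length t = k\<^sup>2 + 2 * k - 2"
proof -
  consider n X a where "(n, X) \<in> set (budgeted (k - 2) (2 * k - 2))" "t = row_string k a X"
    | u v where "t = pair_string k u v"
    using assms(2)
    by (auto simp: reduction_strings_def row_strings_def pair_strings_def split: if_splits)
  then have "length t = k\<^sup>2 + (2 * k - 2)"
    by cases (auto simp: length_row_string length_pair_string dest: budgeted_sound)
  with assms(1) show ?thesis by simp
qed

section \<open>Number of strings\<close>

lemma length_row_strings: "length (row_strings k) = k * 2 ^ (2 * k - 2)"
  by (simp add: row_strings_def length_concat o_def length_budgeted sum_list_triv)

lemma length_pair_strings: "length (pair_strings k E) \<le> k ^ 4"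
proof -
  have "length (concat (map f xs)) \<le> n * length xs" if "\<And>x. length (f x) \<le> n"
    for f :: "nat \<times> nat \<Rightarrow> bool list list" and xs n
    using that by (induction xs) (auto intro: add_mono)
  note bound = this
  have "length (pair_strings k E) \<le> (1 * length (vertex_list k)) * length (vertex_list k)"
    unfolding pair_strings_def by (intro bound) simp
  also have "\<dots> = k ^ 4"
    by (simp flip: power_add)
  finally show ?thesis .
qed

text \<open>With \<open>n = k - 1\<close>, the central coefficient is at least
  \<open>4^n / (2n)\<close>, and its left neighbour is smaller only by the factor
  \<open>n / (n + 1)\<close>, which is at least one half.\<close>

lemma four_power_le_binomial:
  assumes "k \<ge> 2"
  shows "4 ^ (k - 1) \<le> 4 * (k - 1) * ((2 * k - 2) choose (k - 2))"
proof -
  define n where "n = k - 1"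
  have n: "n > 0" "2 * k - 2 = 2 * n" "k - 2 = n - 1"
    using assms by (auto simp: n_def)
  have "real (4 ^ n) \<le> real (2 * n * ((2 * n) choose n))"
    using central_binomial_lower_bound[of n] n by (simp add: field_simps)
  then have "4 ^ n \<le> 2 * n * ((2 * n) choose n)"
    by (simp only: of_nat_le_iff)
  moreover have "n * ((2 * n) choose n) = (n + 1) * ((2 * n) choose (n - 1))"
  proof -
    obtain j where j: "n = Suc j"
      using n(1) by (cases n) auto
    \<comment> \<open>Both sides equal \<open>2j + 2\<close> times
      \<open>(2j + 1) choose j\<close>.\<close>
    have "Suc j * (Suc (Suc (2 * j)) choose Suc j) = (Suc (Suc j)) * (Suc (Suc (2 * j)) choose j)"
      using binomial_absorb_comp[of "Suc (Suc (2 * j))" j] Suc_times_binomial[of j "Suc (2 * j)"]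
      by simp
    with j show ?thesis by simp
  qed
  moreover have "(n + 1) * ((2 * n) choose (n - 1)) \<le> 2 * n * ((2 * n) choose (n - 1))"
    using n by (intro mult_right_mono) auto
  ultimately have "4 ^ n \<le> 2 * (2 * n * ((2 * n) choose (n - 1)))"
    by linarith
  then show ?thesis
    unfolding n(2,3) n_def[symmetric] by (simp only: mult.assoc)
qed

text \<open>The right side grows by the factor 4, the left side by
  \<open>(n + 2)^2 / (n (n + 1))\<close>, which is at most 4 from \<open>n = 2\<close> on. This
  serves to compare the \<open>k^4\<close> pairs with the binomial coefficient.\<close>

lemma cubic_le_four_power: "n * (n + 1) ^ 2 \<le> 2 * (4::nat) ^ n"
proof (induction n)
  case (Suc n)
  show ?case
  proof (cases "n \<le> 1")
    case True
    then have "n = 0 \<or> n = 1" by auto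
    then show ?thesis by (auto simp: power2_eq_square)
  next
    case False
    then have "2 * 2 \<le> n * n"
      by (intro mult_mono) auto
    then have "(n + 2) ^ 2 \<le> 4 * n * (n + 1)"
      by (simp add: power2_eq_square algebra_simps)
    then have "(n + 1) * (n + 2) ^ 2 \<le> 4 * (n * (n + 1) ^ 2)"
      using mult_left_mono[of "(n + 2) ^ 2" "4 * n * (n + 1)" "n + 1"]
      by (simp add: power2_eq_square algebra_simps)
    with Suc show ?thesis by simp
  qed
qed simp

text \<open>The constant is 4 + 8: the bound on \<open>4^(k - 1)\<close> gives 4 for the row
  strings, and \<open>k^2 \<le> 8 * C\<close> gives 8 for the pair strings.\<close>

lemma length_reduction_strings:
  assumes "k \<ge> 2"
  shows "length (reduction_strings k E) \<le> 12 * (k\<^sup>2 * ((2 * k - 2) choose (k - 2)))"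
proof -
  define n where "n = k - 1"
  define C where "C = (2 * k - 2) choose (k - 2)"
  have n: "k = n + 1" "n > 0"
    using assms by (auto simp: n_def)
  have C: "4 ^ n \<le> 4 * n * C"
    using four_power_le_binomial[OF assms] by (simp add: n_def C_def)
  have "n * k\<^sup>2 \<le> 2 * (4 * n * C)"
    using cubic_le_four_power[of n] C unfolding n(1) by linarith
  then have "n * k\<^sup>2 \<le> n * (8 * C)"
    by (simp only: mult_ac)
  then have k2: "k\<^sup>2 \<le> 8 * C"
    using n by simp
  have "k * 2 ^ (2 * k - 2) = k * 4 ^ n"
    by (simp add: n(1) power_mult)
  also have "\<dots> \<le> k * (4 * k * C)"
    using C n by (intro mult_left_mono) (auto intro: order_trans)
  finally have "length (row_strings k) \<le> 4 * (k\<^sup>2 * C)"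
    by (simp add: length_row_strings power2_eq_square algebra_simps)
  moreover have "k ^ 4 \<le> 8 * (k\<^sup>2 * C)"
    using mult_left_mono[OF k2, of "k\<^sup>2"] by (simp add: algebra_simps flip: power_add)
  ultimately show ?thesis
    using length_pair_strings[of k E] by (simp add: reduction_strings_def C_def)
qed

subsection \<open>Running time of nested list traversals\<close>

text \<open>A bound on the running time as a polynomial in the largest number \<open>N\<close> of iterations of
  any single loop; \<open>reach\<close> certifies it together with the postcondition.\<close>

fun time_poly :: "com \<Rightarrow> nat poly" where
  "time_poly (Assign x e) = [:expr_time e + 1:]"
| "time_poly (Seq c1 c2) = time_poly c1 + time_poly c2 + 1"
| "time_poly (Cond e c1 c2) = [:expr_time e + 1:] + time_poly c1 + time_poly c2"
| "time_poly (While e c) = [:0, 1:] * ([:expr_time e + 1:] + time_poly c) + [:expr_time e + 1:]"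

definition reach :: "nat \<Rightarrow> com \<Rightarrow> store \<Rightarrow> (store \<Rightarrow> bool) \<Rightarrow> bool" where
  "reach N c \<sigma> Q \<longleftrightarrow> (\<exists>t \<sigma>'. exec c \<sigma> t \<sigma>' \<and> t \<le> poly (time_poly c) N \<and> Q \<sigma>')"

lemma reach_mono: "reach N c \<sigma> P \<Longrightarrow> (\<And>\<sigma>'. P \<sigma>' \<Longrightarrow> Q \<sigma>') \<Longrightarrow> reach N c \<sigma> Q"
  unfolding reach_def by blast

lemma reach_Assign: "Q (\<sigma>(x := eval_expr e \<sigma>)) \<Longrightarrow> reach N (Assign x e) \<sigma> Q"
  unfolding reach_def using exec.Assign by fastforce

text \<open>The second command sits in the postcondition of the first, so introduction rules run
  through a program front to back.\<close>

lemma reach_Seq: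
  "reach N c1 \<sigma> (\<lambda>\<sigma>'. reach N c2 \<sigma>' Q) \<Longrightarrow> reach N (Seq c1 c2) \<sigma> Q"
  unfolding reach_def using exec.Seq by fastforce

lemma reach_Cond:
  assumes "eval_expr e \<sigma> \<noteq> Leaf \<Longrightarrow> reach N c1 \<sigma> Q" "eval_expr e \<sigma> = Leaf \<Longrightarrow> reach N c2 \<sigma> Q"
  shows "reach N (Cond e c1 c2) \<sigma> Q"
proof (cases "eval_expr e \<sigma> = Leaf")
  case True
  with assms(2) exec.CondFalse[of e \<sigma> c2 _ _ c1] show ?thesis
    unfolding reach_def by fastforce
next
  case False
  with assms(1) exec.CondTrue[of e \<sigma> c1 _ _ c2] show ?thesis
    unfolding reach_def by fastforce
qed

lemma reach_Seq_mono:
  assumes "reach N c1 \<sigma> P" "\<And>\<sigma>'. P \<sigma>' \<Longrightarrow> reach N c2 \<sigma>' Q"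
  shows "reach N (Seq c1 c2) \<sigma> Q"
  using assms by (blast intro: reach_Seq reach_mono)

text \<open>The cursor moves on before the body runs, so the body only has to preserve
  \<open>t\<close>. On a unary number this is a counted loop.\<close>

definition foreach :: "nat \<Rightarrow> nat \<Rightarrow> expr \<Rightarrow> com \<Rightarrow> com" where
  "foreach t x e c = Seq (Assign t e) (While (Var t)
     (Seq (Assign x (Hd_e (Var t))) (Seq (Assign t (Tl_e (Var t))) c)))"

text \<open>Induction on the unread part, with \<open>I\<close> relating the elements done and those
  to come. A round costs the body plus 2 for the test, and the last test 2 more; bounding the rounds
  by \<open>N\<close> gives the linear factor in \<open>time_poly\<close>.\<close>

lemma reach_foreach:
  assumes e: "eval_expr e \<sigma> = enc_list f xs" and N: "length xs \<le> N" and tx: "t \<noteq> x"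
    and init: "I [] xs (\<sigma>(t := enc_list f xs))"
    and step: "\<And>ys y zs \<sigma>. xs = ys @ y # zs \<Longrightarrow> I ys (y # zs) \<sigma> \<Longrightarrow>
      reach N c (\<sigma>(x := f y, t := enc_list f zs))
        (\<lambda>\<sigma>'. \<sigma>' t = enc_list f zs \<and> I (ys @ [y]) zs \<sigma>')"
    and post: "\<And>\<sigma>. I xs [] \<sigma> \<Longrightarrow> Q \<sigma>"
  shows "reach N (foreach t x e c) \<sigma> Q"
proof -
  define b where "b = Seq (Assign x (Hd_e (Var t))) (Seq (Assign t (Tl_e (Var t))) c)"
  have body: "reach N b \<sigma> (\<lambda>\<sigma>'. \<sigma>' t = enc_list f zs \<and> I (ys @ [y]) zs \<sigma>')"
    if "xs = ys @ y # zs" "I ys (y # zs) \<sigma>" "\<sigma> t = enc_list f (y # zs)" for ys y zs \<sigma>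
    unfolding b_def using step[OF that(1,2)] that(3) tx
    by (intro reach_Seq reach_Assign) simp
  have loop: "\<exists>\<tau> \<sigma>'. exec (While (Var t) b) \<sigma> \<tau> \<sigma>' \<and>
      \<tau> \<le> length zs * (poly (time_poly b) N + 2) + 2 \<and> I xs [] \<sigma>'"
    if "xs = ys @ zs" "I ys zs \<sigma>" "\<sigma> t = enc_list f zs" for ys zs \<sigma>
    using that
  proof (induction zs arbitrary: ys \<sigma>)
    case Nil
    then show ?case
      using exec.WhileFalse[of "Var t" \<sigma> b] by auto
  next
    case (Cons y zs)
    obtain t1 \<sigma>1 where 1: "exec b \<sigma> t1 \<sigma>1" "t1 \<le> poly (time_poly b) N"
      "\<sigma>1 t = enc_list f zs" "I (ys @ [y]) zs \<sigma>1"
      using body[OF Cons.prems] unfolding reach_def by blast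
    obtain t2 \<sigma>2 where 2: "exec (While (Var t) b) \<sigma>1 t2 \<sigma>2"
      "t2 \<le> length zs * (poly (time_poly b) N + 2) + 2" "I xs [] \<sigma>2"
      using Cons.IH[of "ys @ [y]" \<sigma>1] Cons.prems 1 by auto
    have "exec (While (Var t) b) \<sigma> (expr_time (Var t) + t1 + t2 + 1) \<sigma>2"
      using 1 2 Cons.prems by (intro exec.WhileTrue) auto
    moreover have "expr_time (Var t) + t1 + t2 + 1 \<le>
        length (y # zs) * (poly (time_poly b) N + 2) + 2"
      using 1 2 by simp
    ultimately show ?case
      using 2 by blast
  qed
  have "reach N (While (Var t) b) (\<sigma>(t := enc_list f xs)) Q"
  proof -
    obtain \<tau> \<sigma>' where r: "exec (While (Var t) b) (\<sigma>(t := enc_list f xs)) \<tau> \<sigma>'"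
      "\<tau> \<le> length xs * (poly (time_poly b) N + 2) + 2" "I xs [] \<sigma>'"
      using loop[of "[]" xs "\<sigma>(t := enc_list f xs)"] init by auto
    have "length xs * (poly (time_poly b) N + 2) \<le> N * (poly (time_poly b) N + 2)"
      using N by (rule mult_right_mono) simp
    with r(2) have "\<tau> \<le> poly (time_poly (While (Var t) b)) N"
      by (simp add: algebra_simps)
    with r post show ?thesis
      unfolding reach_def by blast
  qed
  with e show ?thesis
    unfolding foreach_def b_def[symmetric] by (intro reach_Seq reach_Assign) simp
qed

lemma enc_list_map: "enc_list f (map g xs) = enc_list (\<lambda>x. f (g x)) xs"
  by (induction xs) auto

lemma enc_list_eq_Leaf [simp]: "enc_list f xs = Leaf \<longleftrightarrow> xs = []"
  by (cases xs) auto

lemma enc_bool_eq_Leaf [simp]: "enc_bool b = Leaf \<longleftrightarrow> \<not> b"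
  by (cases b) auto

text \<open>Lets a unary number be traversed as any list of that length, so that counted loops can
  be indexed by \<open>[1..<Suc k]\<close>.\<close>

lemma enc_list_const: "length xs = n \<Longrightarrow> enc_list (\<lambda>_. Leaf) xs = enc_nat n"
  unfolding enc_nat_def by (induction xs arbitrary: n) auto

lemma enc_nat_simps [simp]: "enc_nat 0 = Leaf" "enc_nat (Suc n) = Node Leaf (enc_nat n)"
  by (simp_all add: enc_nat_def)

lemma enc_nat_eq_Leaf [simp]: "enc_nat n = Leaf \<longleftrightarrow> n = 0"
  by (cases n) auto

lemma right_enc_nat [simp]: "right (enc_nat n) = enc_nat (n - 1)"
  by (cases n) auto

subsection \<open>The program\<close>

text \<open>
  Register usage: 1 holds \<open>k\<close>; 2 the unread rows of the adjacency matrix and 23 the unread part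
  of the current row; 3 and 4 unit vectors; 5 and 6 the numbers \<open>2k - 2\<close> and \<open>3k - 3\<close>;
  7 to 9 the budgeted strings; 10 the output strings; 11 to 14 the coordinates of the two current
  vertices and 15 to 18 their unread parts; 19 the string under construction; 20 to 22 vertices;
  29 a dummy; 30 to 33 the loop cursors.
\<close>

abbreviation "True_e \<equiv> Cons_e Nil_e Nil_e"

text \<open>The unit vectors have no trailing zeros: since \<open>left Leaf = right Leaf = Leaf\<close>, reading
  beyond the end of a list yields zeros.\<close>

fun one_hot :: "nat \<Rightarrow> tree" where
  "one_hot 0 = Leaf"
| "one_hot (Suc 0) = Node (Node Leaf Leaf) Leaf"
| "one_hot (Suc (Suc n)) = Node Leaf (one_hot (Suc n))"

text \<open>Positions start at 1 like the coordinates; position 0 coincides with position 1.\<close>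

definition tree_bit :: "tree \<Rightarrow> nat \<Rightarrow> bool" where
  "tree_bit x i \<longleftrightarrow> left ((right ^^ (i - 1)) x) \<noteq> Leaf"

lemma right_pow_Leaf: "(right ^^ n) Leaf = Leaf"
  by (induction n) auto

lemma tree_bit_Leaf [simp]: "\<not> tree_bit Leaf i"
  by (simp add: tree_bit_def right_pow_Leaf)

lemma tree_bit_Node: "tree_bit (Node a b) i \<longleftrightarrow> (if i \<le> 1 then a \<noteq> Leaf else tree_bit b (i - 1))"
proof (cases "i \<le> 1")
  case False
  then obtain j where "i = Suc (Suc j)"
    by (metis One_nat_def Suc_le_mono le0 not0_implies_Suc)
  then show ?thesis
    by (simp add: tree_bit_def funpow_swap1)
qed (simp add: tree_bit_def)

lemma tree_bit_one_hot: "n \<ge> 1 \<Longrightarrow> i \<ge> 1 \<Longrightarrow> tree_bit (one_hot n) i \<longleftrightarrow> i = n"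
  by (induction n arbitrary: i rule: one_hot.induct) (auto simp: tree_bit_Node)

section \<open>Writing one string\<close>

definition frame :: "nat set \<Rightarrow> store \<Rightarrow> store \<Rightarrow> bool" where
  "frame W \<sigma> \<sigma>' \<longleftrightarrow> (\<forall>v. v \<notin> W \<longrightarrow> \<sigma>' v = \<sigma> v)"

lemma frameD: "frame W \<sigma> \<sigma>' \<Longrightarrow> v \<notin> W \<Longrightarrow> \<sigma>' v = \<sigma> v"
  by (simp add: frame_def)

text \<open>Common form of both kinds of vertex parts: unit vectors for the coordinates of
  \<open>u\<close> and \<open>v\<close> give the pair string, and leaves for \<open>b\<close>,
  \<open>c\<close>, \<open>d\<close> leave just the row marked by \<open>a\<close>.\<close>

definition pattern :: "tree \<Rightarrow> tree \<Rightarrow> tree \<Rightarrow> tree \<Rightarrow> nat \<Rightarrow> nat \<Rightarrow> bool" where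
  "pattern a b c d x y \<longleftrightarrow> (if tree_bit a x then \<not> tree_bit b y else tree_bit c x \<and> \<not> tree_bit d y)"

definition emit_block :: com where
  "emit_block = foreach 33 29 (Var 1)
     (Seq (Cond (Hd_e (Var 15))
        (Cond (Hd_e (Var 17)) (Assign 19 (Cons_e Nil_e (Var 19))) (Assign 19 (Cons_e True_e (Var 19))))
        (Cond (Hd_e (Var 16))
          (Cond (Hd_e (Var 18)) (Assign 19 (Cons_e Nil_e (Var 19))) (Assign 19 (Cons_e True_e (Var 19))))
          (Assign 19 (Cons_e Nil_e (Var 19)))))
      (Seq (Assign 17 (Tl_e (Var 17))) (Assign 18 (Tl_e (Var 18)))))"

text \<open>Register 19 must hold the auxiliary tail on entry; the vertex bits are consed in front
  of it.\<close>

definition emit :: com where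
  "emit = Seq (Assign 15 (Var 11)) (Seq (Assign 16 (Var 13))
     (Seq (foreach 32 29 (Var 1)
        (Seq (Assign 17 (Var 12)) (Seq (Assign 18 (Var 14)) (Seq emit_block
          (Seq (Assign 15 (Tl_e (Var 15))) (Assign 16 (Tl_e (Var 16))))))))
      (Assign 10 (Cons_e (Var 19) (Var 10)))))"

lemma product_snoc: "List.product (xs @ [x]) ys = List.product xs ys @ map (Pair x) ys"
  by (simp add: product_concat_map)

lemma rev_product: "rev (List.product xs ys) = List.product (rev xs) (rev ys)"
  by (simp add: product_concat_map rev_concat rev_map o_def)

lemma upt_split:
  assumes "[1..<Suc k] = ys @ y # zs"
  shows "y = Suc (length ys)"
proof -
  have "length ys < k"
    using arg_cong[OF assms, of length] by (simp del: upt_Suc)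
  then show ?thesis
    using arg_cong[OF assms, of "\<lambda>xs. xs ! length ys"] by (simp del: upt_Suc)
qed

lemma reach_emit_block:
  assumes k: "k \<le> N" and K: "\<sigma> 1 = enc_nat k" and Y: "\<sigma> 19 = enc_list enc_bool X"
    and p: "\<And>y. 1 \<le> y \<Longrightarrow> P y \<longleftrightarrow> (if left (\<sigma> 15) \<noteq> Leaf then \<not> tree_bit (\<sigma> 17) y
      else left (\<sigma> 16) \<noteq> Leaf \<and> \<not> tree_bit (\<sigma> 18) y)"
  shows "reach N emit_block \<sigma> (\<lambda>\<sigma>'.
    \<sigma>' 19 = enc_list enc_bool (rev (map P [1..<Suc k]) @ X) \<and> frame {17, 18, 19, 29, 33} \<sigma> \<sigma>')"
  unfolding emit_block_def
proof (rule reach_foreach[where xs = "[1..<Suc k]" and f = "\<lambda>_. Leaf" and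
      I = "\<lambda>ys zs \<sigma>'. \<sigma>' 19 = enc_list enc_bool (rev (map P ys) @ X) \<and>
        \<sigma>' 17 = (right ^^ length ys) (\<sigma> 17) \<and> \<sigma>' 18 = (right ^^ length ys) (\<sigma> 18) \<and>
        frame {17, 18, 19, 29, 33} \<sigma> \<sigma>'"], goal_cases)
  \<comment> \<open>Case 5 is the loop body. After \<open>length ys\<close> tails, the heads are the
    bits at position \<open>y\<close>.\<close>
  case (5 ys y zs \<tau>)
  have y: "y = Suc (length ys)"
    using 5(1) by (rule upt_split)
  have f: "\<tau> 15 = \<sigma> 15" "\<tau> 16 = \<sigma> 16"
    using 5(2) by (auto intro: frameD)
  show ?case
    using 5(2) y f p[of y]
    by (intro reach_Seq reach_Cond reach_Assign) (auto simp: frame_def tree_bit_def)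
qed (use assms in \<open>auto simp: frame_def enc_list_const simp del: upt_Suc\<close>)

lemma reach_emit:
  assumes k: "k \<le> N" and K: "\<sigma> 1 = enc_nat k" and Y: "\<sigma> 19 = enc_list enc_bool X"
    and O: "\<sigma> 10 = enc_list (enc_list enc_bool) ss"
    and p: "\<And>x y. 1 \<le> x \<Longrightarrow> 1 \<le> y \<Longrightarrow> P (x, y) \<longleftrightarrow> pattern (\<sigma> 11) (\<sigma> 12) (\<sigma> 13) (\<sigma> 14) x y"
  shows "reach N emit \<sigma> (\<lambda>\<sigma>'.
    \<sigma>' 10 = enc_list (enc_list enc_bool) ((map P (rev (vertex_list k)) @ X) # ss) \<and>
    frame {10, 15, 16, 17, 18, 19, 29, 32, 33} \<sigma> \<sigma>')"
  unfolding emit_def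
proof (intro reach_Seq reach_Assign, rule reach_foreach[where xs = "[1..<Suc k]" and f = "\<lambda>_. Leaf" and
      I = "\<lambda>ys zs \<sigma>'. \<sigma>' 19 = enc_list enc_bool (rev (map P (List.product ys [1..<Suc k])) @ X) \<and>
        \<sigma>' 15 = (right ^^ length ys) (\<sigma> 11) \<and> \<sigma>' 16 = (right ^^ length ys) (\<sigma> 13) \<and>
        frame {15, 16, 17, 18, 19, 29, 32, 33} \<sigma> \<sigma>'"], goal_cases)
  case (5 ys y zs \<tau>)
  have y: "y = Suc (length ys)"
    using 5(1) by (rule upt_split)
  have f: "\<tau> v = \<sigma> v" if "v \<in> {1, 11, 12, 13, 14}" for v
    using 5(2) that by (auto intro!: frameD)
  have fr: "frame {15, 16, 17, 18, 19, 29, 32, 33} \<sigma> \<tau>"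
    and t19: "\<tau> 19 = enc_list enc_bool (rev (map P (List.product ys [1..<Suc k])) @ X)"
    and t15: "\<tau> 15 = (right ^^ length ys) (\<sigma> 11)" "\<tau> 16 = (right ^^ length ys) (\<sigma> 13)"
    using 5(2) by auto
  have P: "P (y, v) \<longleftrightarrow> (if left (\<tau> 15) \<noteq> Leaf then \<not> tree_bit (\<sigma> 12) v
      else left (\<tau> 16) \<noteq> Leaf \<and> \<not> tree_bit (\<sigma> 14) v)" if "1 \<le> v" for v
    using p[of y v] that unfolding t15 y by (simp add: pattern_def tree_bit_def)
  show ?case
  proof (intro reach_Seq reach_Assign, rule reach_mono[OF reach_emit_block[where k = k and
        X = "rev (map P (List.product ys [1..<Suc k])) @ X" and P = "\<lambda>v. P (y, v)"]], goal_cases)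
    case (5 \<sigma>')
    with fr t15 show ?case
      by (intro reach_Seq reach_Assign) (auto simp: frame_def product_snoc o_def simp del: upt_Suc)
  qed (use K k f t19 P in \<open>simp_all\<close>)
qed (use assms in \<open>auto simp: frame_def enc_list_const vertex_list_def rev_map
    intro!: reach_Assign simp del: upt_Suc\<close>)

section \<open>Tables of unit vectors, numbers, vertices and auxiliary strings\<close>

definition make_units :: com where
  "make_units = Seq (Assign 3 (Cons_e True_e Nil_e)) (Seq (Assign 4 Nil_e)
     (foreach 30 29 (Var 1)
       (Seq (Assign 4 (Cons_e (Var 3) (Var 4))) (Assign 3 (Cons_e Nil_e (Var 3))))))"

text \<open>Consing a leaf moves the single one in register 3 a place further, which gives the next
  unit vector.\<close>

lemma reach_make_units:
  assumes k: "k \<le> N" and K: "\<sigma> 1 = enc_nat k"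
  shows "reach N make_units \<sigma> (\<lambda>\<sigma>'.
    \<sigma>' 4 = enc_list one_hot (rev [1..<Suc k]) \<and> frame {3, 4, 29, 30} \<sigma> \<sigma>')"
  unfolding make_units_def
proof (intro reach_Seq reach_Assign, rule reach_foreach[where xs = "[1..<Suc k]" and f = "\<lambda>_. Leaf" and
      I = "\<lambda>ys zs \<sigma>'. \<sigma>' 3 = one_hot (Suc (length ys)) \<and> \<sigma>' 4 = enc_list one_hot (rev ys) \<and>
        frame {3, 4, 29, 30} \<sigma> \<sigma>'"], goal_cases)
  case (5 ys y zs \<tau>)
  have y: "y = Suc (length ys)"
    using 5(1) by (rule upt_split)
  show ?case
    using 5(2) y by (intro reach_Seq reach_Assign) (auto simp: frame_def)
qed (use assms in \<open>auto simp: frame_def enc_list_const simp del: upt_Suc\<close>)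

definition make_numbers :: com where
  "make_numbers = Seq (Assign 5 Nil_e) (Seq (Assign 6 Nil_e)
     (foreach 30 29 (Tl_e (Var 1))
       (Seq (Assign 5 (Cons_e Nil_e (Cons_e Nil_e (Var 5))))
            (Assign 6 (Cons_e Nil_e (Cons_e Nil_e (Cons_e Nil_e (Var 6))))))))"

lemma reach_make_numbers:
  assumes k: "k \<le> N" and K: "\<sigma> 1 = enc_nat k"
  shows "reach N make_numbers \<sigma> (\<lambda>\<sigma>'.
    \<sigma>' 5 = enc_nat (2 * (k - 1)) \<and> \<sigma>' 6 = enc_nat (3 * (k - 1)) \<and> frame {5, 6, 29, 30} \<sigma> \<sigma>')"
  unfolding make_numbers_def
proof (intro reach_Seq reach_Assign, rule reach_foreach[where xs = "[1..<k]" and f = "\<lambda>_. Leaf" and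
      I = "\<lambda>ys zs \<sigma>'. \<sigma>' 5 = enc_nat (2 * length ys) \<and> \<sigma>' 6 = enc_nat (3 * length ys) \<and>
        frame {5, 6, 29, 30} \<sigma> \<sigma>'"], goal_cases)
  case (5 ys y zs \<tau>)
  then show ?case
    by (intro reach_Seq reach_Assign) (auto simp: frame_def numeral_eq_Suc)
qed (use assms in \<open>auto simp: frame_def enc_list_const\<close>)

text \<open>Unit vectors turn the comparison of coordinates into reading a bit, as expressions offer
  no equality test.\<close>

definition enc_vertex :: "nat \<times> nat \<Rightarrow> tree" where
  "enc_vertex v = Node (one_hot (fst v)) (one_hot (snd v))"

definition make_vertices :: com where
  "make_vertices = Seq (Assign 20 Nil_e)
     (foreach 30 11 (Var 4) (foreach 31 12 (Var 4)
       (Assign 20 (Cons_e (Cons_e (Var 11) (Var 12)) (Var 20)))))"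

text \<open>Descending traversal and consing cancel, so the vertices come out in the order of the
  adjacency matrix.\<close>

lemma reach_make_vertices:
  assumes k: "k \<le> N" and U: "\<sigma> 4 = enc_list one_hot (rev [1..<Suc k])"
  shows "reach N make_vertices \<sigma> (\<lambda>\<sigma>'.
    \<sigma>' 20 = enc_list enc_vertex (vertex_list k) \<and> frame {11, 12, 20, 30, 31} \<sigma> \<sigma>')"
  unfolding make_vertices_def
proof (intro reach_Seq reach_Assign, rule reach_foreach[where xs = "rev [1..<Suc k]" and f = one_hot and
      I = "\<lambda>ys zs \<sigma>'. \<sigma>' 20 = enc_list enc_vertex (rev (List.product ys (rev [1..<Suc k]))) \<and>
        frame {11, 12, 20, 30, 31} \<sigma> \<sigma>'"], goal_cases)
  case (5 ys a zs \<tau>)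
  show ?case
  proof (rule reach_foreach[where xs = "rev [1..<Suc k]" and f = one_hot and
      I = "\<lambda>bs _ \<sigma>'. \<sigma>' 20 = enc_list enc_vertex
          (rev (map (Pair a) bs) @ rev (List.product ys (rev [1..<Suc k]))) \<and>
        \<sigma>' 11 = one_hot a \<and> \<sigma>' 30 = enc_list one_hot zs \<and>
        frame {11, 12, 20, 30, 31} \<sigma> \<sigma>'"], goal_cases)
    case (5 bs b cs \<tau>')
    then show ?case
      by (intro reach_Assign) (auto simp: frame_def enc_vertex_def)
  qed (use 5(2) U k in \<open>auto simp: frame_def product_snoc simp del: upt_Suc\<close>)
qed (use assms in \<open>auto simp: frame_def rev_product vertex_list_def simp del: upt_Suc\<close>)

definition enc_budgeted :: "nat \<times> bool list \<Rightarrow> tree" where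
  "enc_budgeted p = Node (enc_nat (fst p)) (enc_list enc_bool (snd p))"

definition make_budgeted :: com where
  "make_budgeted = Seq (Assign 7 (Cons_e (Cons_e (Tl_e (Tl_e (Var 1))) Nil_e) Nil_e))
     (foreach 30 29 (Var 5) (Seq (Assign 8 Nil_e) (Seq
       (foreach 31 9 (Var 7) (Seq
         (Assign 8 (Cons_e (Cons_e (Hd_e (Var 9)) (Cons_e Nil_e (Tl_e (Var 9)))) (Var 8)))
         (Cond (Hd_e (Var 9))
           (Assign 8 (Cons_e (Cons_e (Tl_e (Hd_e (Var 9))) (Cons_e True_e (Tl_e (Var 9)))) (Var 8)))
           (Assign 8 (Cons_e (Cons_e Nil_e (Cons_e Nil_e (Tl_e (Var 9)))) (Var 8))))))
       (Assign 7 (Var 8)))))"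

text \<open>Round \<open>j\<close> traverses \<open>2^j\<close> entries with \<open>j < n\<close>,
  and the outer loop makes \<open>n < 2^n\<close> rounds; hence the bound \<open>2^n\<close> on loop
  lengths.\<close>

lemma reach_make_budgeted:
  assumes n: "2 ^ n \<le> N" and K: "\<sigma> 1 = enc_nat k" and D: "\<sigma> 5 = enc_nat n"
  shows "reach N make_budgeted \<sigma> (\<lambda>\<sigma>'.
    \<sigma>' 7 = enc_list enc_budgeted (budgeted (k - 2) n) \<and> frame {7, 8, 9, 29, 30, 31} \<sigma> \<sigma>')"
  unfolding make_budgeted_def
proof (intro reach_Seq reach_Assign, rule reach_foreach[where xs = "[0..<n]" and f = "\<lambda>_. Leaf" and
      I = "\<lambda>ys zs \<sigma>'. \<sigma>' 7 = enc_list enc_budgeted (budgeted (k - 2) (length ys)) \<and>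
        frame {7, 8, 9, 29, 30, 31} \<sigma> \<sigma>'"], goal_cases)
  case 2
  have "n \<le> N"
    using n less_exp[of n] by linarith
  then show ?case by simp
next
  case (5 ys y zs \<tau>)
  have "length ys \<le> n"
    using arg_cong[OF 5(1), of length] by simp
  then have "2 ^ length ys \<le> (2::nat) ^ n"
    by (intro power_increasing) auto
  also note n
  finally have len: "length (budgeted (k - 2) (length ys)) \<le> N"
    by (simp add: length_budgeted)
  show ?case
  proof (intro reach_Seq reach_Assign, rule reach_foreach[where xs = "budgeted (k - 2) (length ys)"
      and f = enc_budgeted and
      I = "\<lambda>bs _ \<sigma>'. \<sigma>' 8 = enc_list enc_budgeted (rev (concat (map spend bs))) \<and>
        \<sigma>' 30 = enc_list (\<lambda>_. Leaf) zs \<and> frame {7, 8, 9, 29, 30, 31} \<sigma> \<sigma>'"], goal_cases)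
    case (5 bs b cs \<tau>')
    then show ?case
      by (intro reach_Seq reach_Cond reach_Assign; cases b) (auto simp: frame_def enc_budgeted_def)
  qed (use 5(2) len in \<open>auto simp: frame_def intro!: reach_Assign\<close>)
qed (use assms in \<open>auto simp: frame_def enc_list_const enc_budgeted_def numeral_eq_Suc\<close>)

section \<open>Emitting the row strings and the pair strings\<close>

definition emit_row_strings :: com where
  "emit_row_strings = Seq (Assign 10 Nil_e) (Seq (Assign 12 Nil_e) (Seq (Assign 13 Nil_e)
     (Seq (Assign 14 Nil_e)
       (foreach 30 11 (Var 4) (foreach 31 9 (Var 7) (Seq (Assign 19 (Tl_e (Var 9))) emit))))))"

lemma reach_emit_row_strings:
  assumes k: "k \<le> N" and n: "2 ^ (2 * k - 2) \<le> N" and K: "\<sigma> 1 = enc_nat k"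
    and U: "\<sigma> 4 = enc_list one_hot (rev [1..<Suc k])"
    and L: "\<sigma> 7 = enc_list enc_budgeted (budgeted (k - 2) (2 * k - 2))"
  shows "reach N emit_row_strings \<sigma> (\<lambda>\<sigma>'.
    \<sigma>' 10 = enc_list (enc_list enc_bool) (rev (row_strings k)) \<and>
    frame ({9..19} \<union> {29..33}) \<sigma> \<sigma>')"
  unfolding emit_row_strings_def
proof (intro reach_Seq reach_Assign, rule reach_foreach[where xs = "rev [1..<Suc k]" and f = one_hot and
      I = "\<lambda>ys zs \<sigma>'. \<sigma>' 10 = enc_list (enc_list enc_bool) (rev (concat (map (\<lambda>a.
          map (\<lambda>(n, X). row_string k a X) (budgeted (k - 2) (2 * k - 2))) ys))) \<and>
        \<sigma>' 12 = Leaf \<and> \<sigma>' 13 = Leaf \<and> \<sigma>' 14 = Leaf \<and>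
        frame ({9..19} \<union> {29..33}) \<sigma> \<sigma>'"], goal_cases)
  case (5 ys a zs \<tau>)
  have a: "1 \<le> a"
    using arg_cong[OF 5(1), of set] by auto
  let ?ss = "rev (concat (map (\<lambda>a.
    map (\<lambda>(n, X). row_string k a X) (budgeted (k - 2) (2 * k - 2))) ys))"
  show ?case
  proof (rule reach_foreach[where xs = "budgeted (k - 2) (2 * k - 2)" and f = enc_budgeted and
      I = "\<lambda>bs _ \<sigma>'. \<sigma>' 10 = enc_list (enc_list enc_bool)
          (rev (map (\<lambda>(n, X). row_string k a X) bs) @ ?ss) \<and>
        \<sigma>' 11 = one_hot a \<and> \<sigma>' 12 = Leaf \<and> \<sigma>' 13 = Leaf \<and> \<sigma>' 14 = Leaf \<and>
        \<sigma>' 30 = enc_list one_hot zs \<and> frame ({9..19} \<union> {29..33}) \<sigma> \<sigma>'"], goal_cases)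
    case (5 bs b cs \<tau>')
    then show ?case
      using k K a
      by (intro reach_Seq reach_Assign reach_mono[OF reach_emit[where k = k and X = "snd b" and
            ss = "rev (map (\<lambda>(n, X). row_string k a X) bs) @ ?ss" and P = "\<lambda>(x, y). x = a"]])
        (auto simp: frame_def enc_budgeted_def pattern_def tree_bit_one_hot row_string_def
          split: prod.splits)
  qed (use 5(2) L k n in \<open>auto simp: frame_def length_budgeted\<close>)
qed (use assms in \<open>auto simp: frame_def row_strings_def simp del: upt_Suc\<close>)

text \<open>The matrix is read in step with the vertex list. Register 5 doubles as the zero tail,
  since the unary \<open>2k - 2\<close> is literally a string of that many zeros. For adjacent pairs
  the assignment to 29 merely idles.\<close>

definition emit_pair_strings :: com where
  "emit_pair_strings = foreach 30 21 (Var 20)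
     (Seq (Assign 23 (Hd_e (Var 2))) (Seq (Assign 2 (Tl_e (Var 2)))
     (Seq (Assign 11 (Hd_e (Var 21))) (Seq (Assign 12 (Tl_e (Var 21)))
       (foreach 31 22 (Var 20)
         (Seq (Assign 13 (Hd_e (Var 22))) (Seq (Assign 14 (Tl_e (Var 22)))
         (Seq (Assign 19 (Var 5))
         (Seq (Cond (Hd_e (Var 23)) (Assign 29 Nil_e) emit)
           (Assign 23 (Tl_e (Var 23))))))))))))"

lemma reach_emit_pair_strings:
  assumes k: "k \<le> N" and n: "k\<^sup>2 \<le> N" and K: "\<sigma> 1 = enc_nat k"
    and A: "\<sigma> 2 = enc_list (enc_list enc_bool) (adj_matrix k E)"
    and D: "\<sigma> 5 = enc_nat (2 * k - 2)"
    and V: "\<sigma> 20 = enc_list enc_vertex (vertex_list k)"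
    and O: "\<sigma> 10 = enc_list (enc_list enc_bool) ss"
  shows "reach N emit_pair_strings \<sigma> (\<lambda>\<sigma>'.
    \<sigma>' 10 = enc_list (enc_list enc_bool) (rev (pair_strings k E) @ ss) \<and>
    frame ({2} \<union> {10..19} \<union> {21..33}) \<sigma> \<sigma>')"
proof -
  let ?W = "{2} \<union> {10..19} \<union> {21..33}"
  let ?r = "\<lambda>u vs. enc_list (\<lambda>v. enc_bool ({u, v} \<in> E)) vs"
  let ?row = "\<lambda>u vs. concat (map (\<lambda>v. if {u, v} \<in> E then [] else [pair_string k u v]) vs)"
  let ?rows = "\<lambda>us. concat (map (\<lambda>u. ?row u (vertex_list k)) us)"
  show ?thesis
    unfolding emit_pair_strings_def
  proof (rule reach_foreach[where xs = "vertex_list k" and f = enc_vertex and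
      I = "\<lambda>us ws \<sigma>'. \<sigma>' 10 = enc_list (enc_list enc_bool) (rev (?rows us) @ ss) \<and>
        \<sigma>' 2 = enc_list (\<lambda>u. ?r u (vertex_list k)) ws \<and> frame ?W \<sigma> \<sigma>'"], goal_cases)
    case (5 us u ws \<tau>)
    have "u \<in> set (vertex_list k)"
      unfolding 5(1) by simp
    then have u: "1 \<le> fst u" "1 \<le> snd u"
      by (auto simp: kk_vertices_def)
    show ?case
    proof (intro reach_Seq reach_Assign, rule reach_foreach[where xs = "vertex_list k" and f = enc_vertex and
        I = "\<lambda>vs vs' \<sigma>'. \<sigma>' 10 = enc_list (enc_list enc_bool) (rev (?row u vs) @ rev (?rows us) @ ss) \<and>
          \<sigma>' 2 = enc_list (\<lambda>u. ?r u (vertex_list k)) ws \<and> \<sigma>' 11 = one_hot (fst u) \<and>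
          \<sigma>' 12 = one_hot (snd u) \<and> \<sigma>' 23 = ?r u vs' \<and> \<sigma>' 30 = enc_list enc_vertex ws \<and>
          frame ?W \<sigma> \<sigma>'"], goal_cases)
      case (5 vs v vs' \<tau>')
      have "v \<in> set (vertex_list k)"
        unfolding 5(1) by simp
      then have v: "1 \<le> fst v" "1 \<le> snd v"
        by (auto simp: kk_vertices_def)
      show ?case
      proof (cases "{u, v} \<in> E")
        case True
        with 5(2) show ?thesis
          by (intro reach_Seq reach_Assign reach_Cond) (auto simp: frame_def)
      next
        case False
        with 5(2) k K D u v show ?thesis
          by (intro reach_Seq reach_Assign reach_Cond, simp,
              intro reach_mono[OF reach_emit[where k = k and X = "replicate (2 * k - 2) False" and
                ss = "rev (?row u vs) @ rev (?rows us) @ ss" and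
                P = "\<lambda>(x, y). if x = fst u then y \<noteq> snd u else x = fst v \<and> y \<noteq> snd v"]] reach_Assign)
            (auto simp: frame_def enc_vertex_def pattern_def tree_bit_one_hot pair_string_def
              enc_nat_def)
      qed
    qed (use 5(2) V n in \<open>auto simp: frame_def enc_vertex_def\<close>)
  qed (use assms in \<open>auto simp: frame_def pair_strings_def adj_matrix_def enc_list_map\<close>)
qed

section \<open>The whole program and its running time\<close>

definition reduction :: com where
  "reduction = Seq (Assign 1 (Hd_e (Var 0))) (Seq (Assign 2 (Tl_e (Var 0)))
     (Seq make_units (Seq make_numbers (Seq make_vertices (Seq make_budgeted
     (Seq emit_row_strings (Seq emit_pair_strings
       (Assign 0 (Cons_e (Var 10) (Cons_e (Var 1) (Var 6)))))))))))"

text \<open>Built from the last command backwards: each numbered fact assumes the register contents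
  that the rest of the program reads.\<close>

lemma reach_reduction:
  assumes "k \<le> N" "k\<^sup>2 \<le> N" "2 ^ (2 * k - 2) \<le> N" and \<sigma>: "\<sigma> 0 = enc_kk_clique k E"
  shows "reach N reduction \<sigma>
    (\<lambda>\<sigma>'. \<sigma>' 0 = enc_minimax_approval (reduction_strings k E) k (3 * k - 3))"
proof -
  define Q where "Q \<sigma>' \<longleftrightarrow> \<sigma>' 0 = enc_minimax_approval (reduction_strings k E) k (3 * k - 3)"
    for \<sigma>' :: store
  define c where "c = Assign 0 (Cons_e (Var 10) (Cons_e (Var 1) (Var 6)))"
  have 1: "reach N (Seq emit_pair_strings c) \<tau> Q"
    if "\<tau> 1 = enc_nat k" "\<tau> 2 = enc_list (enc_list enc_bool) (adj_matrix k E)"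
      "\<tau> 5 = enc_nat (2 * k - 2)" "\<tau> 6 = enc_nat (3 * k - 3)"
      "\<tau> 20 = enc_list enc_vertex (vertex_list k)"
      "\<tau> 10 = enc_list (enc_list enc_bool) (rev (row_strings k))" for \<tau>
    using that assms
    by (intro reach_Seq_mono[OF reach_emit_pair_strings[where \<sigma> = \<tau>]])
      (auto simp: c_def Q_def frame_def reduction_strings_def enc_minimax_approval_def
        intro!: reach_Assign)
  have 2: "reach N (Seq emit_row_strings (Seq emit_pair_strings c)) \<tau> Q"
    if "\<tau> 1 = enc_nat k" "\<tau> 2 = enc_list (enc_list enc_bool) (adj_matrix k E)"
      "\<tau> 4 = enc_list one_hot (rev [1..<Suc k])"
      "\<tau> 5 = enc_nat (2 * k - 2)" "\<tau> 6 = enc_nat (3 * k - 3)"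
      "\<tau> 7 = enc_list enc_budgeted (budgeted (k - 2) (2 * k - 2))"
      "\<tau> 20 = enc_list enc_vertex (vertex_list k)" for \<tau>
    using that assms
    by (intro reach_Seq_mono[OF reach_emit_row_strings[where \<sigma> = \<tau>] 1]) (auto simp: frame_def)
  have 3: "reach N (Seq make_budgeted (Seq emit_row_strings (Seq emit_pair_strings c))) \<tau> Q"
    if "\<tau> 1 = enc_nat k" "\<tau> 2 = enc_list (enc_list enc_bool) (adj_matrix k E)"
      "\<tau> 4 = enc_list one_hot (rev [1..<Suc k])"
      "\<tau> 5 = enc_nat (2 * k - 2)" "\<tau> 6 = enc_nat (3 * k - 3)"
      "\<tau> 20 = enc_list enc_vertex (vertex_list k)" for \<tau>
    using that assms
    by (intro reach_Seq_mono[OF reach_make_budgeted[where \<sigma> = \<tau>] 2]) (auto simp: frame_def)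
  have 4: "reach N (Seq make_vertices (Seq make_budgeted
      (Seq emit_row_strings (Seq emit_pair_strings c)))) \<tau> Q"
    if "\<tau> 1 = enc_nat k" "\<tau> 2 = enc_list (enc_list enc_bool) (adj_matrix k E)"
      "\<tau> 4 = enc_list one_hot (rev [1..<Suc k])"
      "\<tau> 5 = enc_nat (2 * k - 2)" "\<tau> 6 = enc_nat (3 * k - 3)" for \<tau>
    using that assms
    by (intro reach_Seq_mono[OF reach_make_vertices[where \<sigma> = \<tau>] 3]) (auto simp: frame_def)
  have 5: "reach N (Seq make_numbers (Seq make_vertices (Seq make_budgeted
      (Seq emit_row_strings (Seq emit_pair_strings c))))) \<tau> Q"
    if "\<tau> 1 = enc_nat k" "\<tau> 2 = enc_list (enc_list enc_bool) (adj_matrix k E)"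
      "\<tau> 4 = enc_list one_hot (rev [1..<Suc k])" for \<tau>
    using that assms
    by (intro reach_Seq_mono[OF reach_make_numbers[where \<sigma> = \<tau>] 4])
      (auto simp: frame_def right_diff_distrib')
  have 6: "reach N (Seq make_units (Seq make_numbers (Seq make_vertices (Seq make_budgeted
      (Seq emit_row_strings (Seq emit_pair_strings c)))))) \<tau> Q"
    if "\<tau> 1 = enc_nat k" "\<tau> 2 = enc_list (enc_list enc_bool) (adj_matrix k E)" for \<tau>
    using that assms
    by (intro reach_Seq_mono[OF reach_make_units[where \<sigma> = \<tau>] 5]) (auto simp: frame_def)
  show ?thesis
    unfolding reduction_def c_def[symmetric] Q_def[symmetric, abs_def] using \<sigma>
    by (intro reach_Seq reach_Assign 6) (simp_all add: enc_kk_clique_def)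
qed

theorem lemma1:
  "\<exists>(A :: com) (p :: nat poly) (c :: nat).
     \<forall>(k :: nat) (E :: (nat \<times> nat) set set). k \<ge> 2 \<and> kk_graph k E \<longrightarrow>
       (\<exists>(ss :: bool list list) (S :: bool list multiset) (d :: nat) (t :: nat).
          S = mset ss \<and>
          runs A (enc_kk_clique k E) t (enc_minimax_approval ss k d) \<and>
          (minimax_approval (k\<^sup>2 + 2 * k - 2) S k d \<longleftrightarrow> kk_clique k E) \<and>
          d = 3 * k - 3 \<and>
          size S \<le> c * (k\<^sup>2 * ((2 * k - 2) choose (k - 2))) \<and>
          (\<forall>s\<in>#S. length s = k\<^sup>2 + 2 * k - 2) \<and>
          t \<le> poly p (size (enc_minimax_approval ss k d)))"
proof (rule exI[of _ reduction], rule exI[of _ "time_poly reduction"], rule exI[of _ 12],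
    intro allI impI)
  fix k :: nat and E :: "(nat \<times> nat) set set"
  assume "k \<ge> 2 \<and> kk_graph k E"
  then have k: "k \<ge> 2"
    by simp
  define ss where "ss = reduction_strings k E"
  \<comment> \<open>The output size serves as the loop bound: the output contains
    \<open>k * 2^(2k - 2)\<close> row strings, and no loop makes more rounds than that.\<close>
  define N where "N = size (enc_minimax_approval ss k (3 * k - 3))"
  have "length xs \<le> size (enc_list (enc_list enc_bool) xs)" for xs
    by (induction xs) auto
  then have "length ss \<le> N"
    by (simp add: N_def enc_minimax_approval_def trans_le_add1 le_SucI)
  moreover have "length (row_strings k) \<le> length ss"
    by (simp add: ss_def reduction_strings_def)
  ultimately have len: "k * 2 ^ (2 * k - 2) \<le> N"
    by (simp add: length_row_strings)
  have "k \<le> 2 ^ k"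
    by (simp add: less_imp_le)
  \<comment> \<open>Here \<open>k \<le> 2k - 2\<close>, as \<open>k \<ge> 2\<close>.\<close>
  also have "(2::nat) ^ k \<le> 2 ^ (2 * k - 2)"
    using k by (intro power_increasing) auto
  finally have "k * k \<le> k * 2 ^ (2 * k - 2)"
    by (rule mult_left_mono) simp
  moreover have "1 * 2 ^ (2 * k - 2) \<le> k * 2 ^ (2 * k - 2)"
    using k by (intro mult_right_mono) auto
  moreover have "k * 1 \<le> k * k"
    using k by (intro mult_left_mono) auto
  ultimately have N: "k \<le> N" "k\<^sup>2 \<le> N" "2 ^ (2 * k - 2) \<le> N"
    using len unfolding power2_eq_square by linarith+
  obtain t where t: "runs reduction (enc_kk_clique k E) t (enc_minimax_approval ss k (3 * k - 3))"
      "t \<le> poly (time_poly reduction) N"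
    using reach_reduction[OF N, of "(\<lambda>_. Leaf)(0 := enc_kk_clique k E)" E]
    unfolding reach_def runs_def ss_def by auto
  show "\<exists>(ss :: bool list list) (S :: bool list multiset) (d :: nat) (t :: nat).
     S = mset ss \<and>
     runs reduction (enc_kk_clique k E) t (enc_minimax_approval ss k d) \<and>
     (minimax_approval (k\<^sup>2 + 2 * k - 2) S k d \<longleftrightarrow> kk_clique k E) \<and>
     d = 3 * k - 3 \<and>
     size S \<le> 12 * (k\<^sup>2 * ((2 * k - 2) choose (k - 2))) \<and>
     (\<forall>s\<in>#S. length s = k\<^sup>2 + 2 * k - 2) \<and>
     t \<le> poly (time_poly reduction) (size (enc_minimax_approval ss k d))"
    using t minimax_approval_iff_clique[OF k, of E] length_reduction_strings[OF k, of E]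
      length_reduction_string[OF k, of _ E]
    unfolding N_def ss_def
    by (intro exI[of _ "reduction_strings k E"] exI[of _ "mset (reduction_strings k E)"]
        exI[of _ "3 * k - 3"] exI[of _ t]) auto
qed

end
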